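(* Let $L$ be a Fomin lattice with minimum element $\hat{0}$, value set $V$, differential degree $r$ and weighting $w$. Then its truncation $L_/$, with differential degree $r$ and weighting the restriction of $w$ to coverings in $L_/$, is a Fomin lattice with minimum element $\hat{0}$.
   Context: A Fomin lattice consists of: a lattice $L$ that is modular, locally finite, and in which every element has finitely many upper covers and finitely many lower covers; a module $V$ (the set of values) over a unital ring; an element $r\in V$ (the differential degree); and a function $w$ assigning to every covering $x\lessdot y$ of $L$ a value in $V$, such that (a) for all $x\in L$, $\sum_{y\lessdot x} w(y\lessdot x)+r=\sum_{x\lessdot z}w(x\lessdot z)$, and (b) $w$ is projective-constant: whenever $x\vee y$ covers both $x$ and $y$ and $x\wedge y$ is covered by both, then $w(x\wedge y\lessdot x)=w(y\lessdot x\vee y)$ and $w(x\wedge y\lessdot y)=w(x\lessdot x\vee y)$. Let $S$ be the set of coverings $x\lessdot y$ with $w(x\lessdot y)=0$. For $x,y\in L$, write $x\sim y$ if no covering in a maximal chain (path of successive coverings) from $x\wedge y$ to $x\vee y$ lies in $S$ (this is independent of the chain). The truncation $L_/$ is $\{x\in L: x\sim\hat{0}\}$, regarded as a sublattice of $L$. *)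

theory Defs
  imports "HOL-Algebra.Lattice" "HOL-Algebra.Module" "HOL-Library.FuncSet"
begin

text \<open>The library locale \<^locale>\<open>module\<close> requires a commutative base ring; here the ring is
  merely unital (and may be the zero ring).\<close>

locale left_module = R?: ring R + V?: abelian_group V
  for R :: "('k, 'm) ring_scheme" and V :: "('k, 'v, 'n) module_scheme" +
  assumes smult_closed:
      "\<lbrakk>a \<in> carrier R; x \<in> carrier V\<rbrakk> \<Longrightarrow> a \<odot>\<^bsub>V\<^esub> x \<in> carrier V"
    and smult_l_distr:
      "\<lbrakk>a \<in> carrier R; b \<in> carrier R; x \<in> carrier V\<rbrakk> \<Longrightarrow>
        (a \<oplus>\<^bsub>R\<^esub> b) \<odot>\<^bsub>V\<^esub> x = (a \<odot>\<^bsub>V\<^esub> x) \<oplus>\<^bsub>V\<^esub> (b \<odot>\<^bsub>V\<^esub> x)"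
    and smult_r_distr:
      "\<lbrakk>a \<in> carrier R; x \<in> carrier V; y \<in> carrier V\<rbrakk> \<Longrightarrow>
        a \<odot>\<^bsub>V\<^esub> (x \<oplus>\<^bsub>V\<^esub> y) = (a \<odot>\<^bsub>V\<^esub> x) \<oplus>\<^bsub>V\<^esub> (a \<odot>\<^bsub>V\<^esub> y)"
    and smult_assoc1:
      "\<lbrakk>a \<in> carrier R; b \<in> carrier R; x \<in> carrier V\<rbrakk> \<Longrightarrow>
        (a \<otimes>\<^bsub>R\<^esub> b) \<odot>\<^bsub>V\<^esub> x = a \<odot>\<^bsub>V\<^esub> (b \<odot>\<^bsub>V\<^esub> x)"
    and smult_one:
      "x \<in> carrier V \<Longrightarrow> \<one>\<^bsub>R\<^esub> \<odot>\<^bsub>V\<^esub> x = x"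

definition covers :: "('a, 'm) gorder_scheme \<Rightarrow> 'a \<Rightarrow> 'a \<Rightarrow> bool" where
  "covers L x y \<longleftrightarrow> x \<in> carrier L \<and> y \<in> carrier L \<and> x \<sqsubset>\<^bsub>L\<^esub> y \<and>
     (\<nexists>z. z \<in> carrier L \<and> x \<sqsubset>\<^bsub>L\<^esub> z \<and> z \<sqsubset>\<^bsub>L\<^esub> y)" \<comment> \<open>\<open>y\<close> covers \<open>x\<close>\<close>

definition coverings :: "('a, 'm) gorder_scheme \<Rightarrow> ('a \<times> 'a) set" where
  "coverings L = {(x, y). covers L x y}"

text \<open>Only the values of the weighting \<open>w\<close> on \<^term>\<open>coverings L\<close> are relevant.\<close>

locale fomin_lattice = lattice L + left_module R V
  for L :: "('a, 'm) gorder_scheme" and R :: "('k, 'l) ring_scheme"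
    and V :: "('k, 'v, 'n) module_scheme" and r :: 'v and w :: "'a \<times> 'a \<Rightarrow> 'v" +
  assumes modular:
      "\<lbrakk>x \<in> carrier L; y \<in> carrier L; z \<in> carrier L; x \<sqsubseteq>\<^bsub>L\<^esub> z\<rbrakk> \<Longrightarrow>
        x \<squnion>\<^bsub>L\<^esub> (y \<sqinter>\<^bsub>L\<^esub> z) = (x \<squnion>\<^bsub>L\<^esub> y) \<sqinter>\<^bsub>L\<^esub> z"
    and locally_finite:
      "\<lbrakk>x \<in> carrier L; y \<in> carrier L\<rbrakk> \<Longrightarrow> finite \<lbrace>x..y\<rbrace>\<^bsub>L\<^esub>"
    and finite_upper_covers:
      "x \<in> carrier L \<Longrightarrow> finite {z. covers L x z}"
    and finite_lower_covers:
      "x \<in> carrier L \<Longrightarrow> finite {y. covers L y x}"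
    and degree_closed: "r \<in> carrier V"
    and weight_closed: "w \<in> coverings L \<rightarrow> carrier V"
    and differential:
      "x \<in> carrier L \<Longrightarrow>
        (\<Oplus>\<^bsub>V\<^esub>y\<in>{y. covers L y x}. w (y, x)) \<oplus>\<^bsub>V\<^esub> r = (\<Oplus>\<^bsub>V\<^esub>z\<in>{z. covers L x z}. w (x, z))"
    and projective_constant:
      "\<lbrakk>covers L x (x \<squnion>\<^bsub>L\<^esub> y); covers L y (x \<squnion>\<^bsub>L\<^esub> y);
        covers L (x \<sqinter>\<^bsub>L\<^esub> y) x; covers L (x \<sqinter>\<^bsub>L\<^esub> y) y\<rbrakk> \<Longrightarrow>
        w (x \<sqinter>\<^bsub>L\<^esub> y, x) = w (y, x \<squnion>\<^bsub>L\<^esub> y) \<and> w (x \<sqinter>\<^bsub>L\<^esub> y, y) = w (x, x \<squnion>\<^bsub>L\<^esub> y)"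

definition zero_coverings ::
  "('a, 'm) gorder_scheme \<Rightarrow> ('k, 'v, 'n) module_scheme \<Rightarrow> ('a \<times> 'a \<Rightarrow> 'v) \<Rightarrow> ('a \<times> 'a) set" where
  "zero_coverings L V w = {c \<in> coverings L. w c = \<zero>\<^bsub>V\<^esub>}"

definition covering_path :: "('a, 'm) gorder_scheme \<Rightarrow> 'a \<Rightarrow> 'a list \<Rightarrow> 'a \<Rightarrow> bool" where
  "covering_path L x p y \<longleftrightarrow>
     p \<noteq> [] \<and> set p \<subseteq> carrier L \<and> hd p = x \<and> last p = y \<and> successively (covers L) p"

text \<open>In a Fomin lattice, whether a covering path between two given elements meets
  \<^const>\<open>zero_coverings\<close> does not depend on the path, and by local finiteness there always is
  one, so the existential quantifier could equivalently be universal.\<close>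

definition trunc_equiv ::
  "('a, 'm) gorder_scheme \<Rightarrow> ('k, 'v, 'n) module_scheme \<Rightarrow> ('a \<times> 'a \<Rightarrow> 'v) \<Rightarrow> 'a \<Rightarrow> 'a \<Rightarrow> bool" where
  "trunc_equiv L V w x y \<longleftrightarrow>
     (\<exists>p. covering_path L (x \<sqinter>\<^bsub>L\<^esub> y) p (x \<squnion>\<^bsub>L\<^esub> y) \<and>
          set (zip p (tl p)) \<inter> zero_coverings L V w = {})"

text \<open>The order of the truncation is the restriction of that of \<open>L\<close>; the argument \<open>b\<close> is meant
  to be the minimum of \<open>L\<close>.\<close>

definition truncation ::
  "('a, 'm) gorder_scheme \<Rightarrow> ('k, 'v, 'n) module_scheme \<Rightarrow> ('a \<times> 'a \<Rightarrow> 'v) \<Rightarrow> 'a \<Rightarrow>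
   ('a, 'm) gorder_scheme" where
  "truncation L V w b = L\<lparr>carrier := {x \<in> carrier L. trunc_equiv L V w x b}\<rparr>"

definition sublattice_carrier :: "'a set \<Rightarrow> ('a, 'm) gorder_scheme \<Rightarrow> bool" where
  "sublattice_carrier A L \<longleftrightarrow>
     A \<subseteq> carrier L \<and> (\<forall>x\<in>A. \<forall>y\<in>A. x \<squnion>\<^bsub>L\<^esub> y \<in> A \<and> x \<sqinter>\<^bsub>L\<^esub> y \<in> A)"

end

theory Submission
  imports Defs
begin

text \<open>Call an element reachable if it ends a covering path from \<open>b\<close> along coverings of nonzero
  weight. Projective-constancy extends from squares to arbitrary perspective coverings: if
  \<open>d \<sqinter> c\<close> is covered by \<open>c\<close>, then \<open>d\<close> is covered by \<open>d \<squnion> c\<close> with the same weight. Moving the last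
  covering of a path along such perspectivities shows that the reachable elements are closed under
  joins and downward closed, and that every covering between reachable elements has nonzero weight.
  Hence the truncation keeps all lower coverings of its elements and omits exactly the upper coverings
  of weight zero, which do not contribute to the differential condition.\<close>

section \<open>Reachability along coverings of nonzero weight\<close>

text \<open>Replaces path lists by an inductive predicate, so that later arguments treat only the
  last covering of a path.\<close>

inductive reachable ::
  "('a, 'm) gorder_scheme \<Rightarrow> ('k, 'v, 'n) module_scheme \<Rightarrow> ('a \<times> 'a \<Rightarrow> 'v) \<Rightarrow> 'a \<Rightarrow> 'a \<Rightarrow> bool"
  for L V w b where
  base: "reachable L V w b b"
| step: "\<lbrakk>reachable L V w b x; covers L x y; w (x, y) \<noteq> \<zero>\<^bsub>V\<^esub>\<rbrakk> \<Longrightarrow> reachable L V w b y"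

text \<open>Puts the condition on consecutive pairs from \<open>trunc_equiv\<close> into the form of
  the covering condition in \<open>covering_path\<close>; \<open>successively_conj\<close> then
  merges the two.\<close>

lemma zip_tl_disjoint_iff:
  "set (zip p (tl p)) \<inter> Z = {} \<longleftrightarrow> successively (\<lambda>x y. (x, y) \<notin> Z) p"
  by (induction p rule: induct_list012) auto

lemma successively_conj:
  "successively (\<lambda>x y. P x y \<and> Q x y) p \<longleftrightarrow> successively P p \<and> successively Q p"
  by (induction p rule: induct_list012) auto

lemma reachable_iff_path:
  assumes "b \<in> carrier L"
  shows "reachable L V w b x \<longleftrightarrow>
    (\<exists>p. covering_path L b p x \<and> set (zip p (tl p)) \<inter> zero_coverings L V w = {})"
proof
  assume "reachable L V w b x"
  then show "\<exists>p. covering_path L b p x \<and> set (zip p (tl p)) \<inter> zero_coverings L V w = {}"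
  proof induction
    case base
    show ?case
      \<comment> \<open>The one-element path has no consecutive pairs; \<open>assms\<close> places
        it inside the carrier.\<close>
      using assms by (intro exI[of _ "[b]"]) (simp add: covering_path_def)
  next
    case (step x y)
    then obtain p where p: "covering_path L b p x"
        "set (zip p (tl p)) \<inter> zero_coverings L V w = {}"
      by blast
    with step.hyps show ?case
      unfolding zip_tl_disjoint_iff
      by (intro exI[of _ "p @ [y]"])
        (auto simp: covering_path_def successively_append_iff zero_coverings_def covers_def)
  qed
next
  \<comment> \<open>Reachability grows at the far end of a path, hence the induction from the right
    with a claim about \<open>last p\<close>.\<close>
  have "reachable L V w b (last p)"
    if "p \<noteq> []" "hd p = b"
      "successively (\<lambda>x y. covers L x y \<and> (x, y) \<notin> zero_coverings L V w) p" for p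
    using that
  proof (induction p rule: rev_induct)
    case (snoc y p)
    show ?case
    proof (cases "p = []")
      case True
      with snoc show ?thesis by (auto intro: reachable.base)
    next
      case False
      with snoc have "reachable L V w b (last p)" "covers L (last p) y"
        "(last p, y) \<notin> zero_coverings L V w"
        by (auto simp: successively_append_iff)
      then show ?thesis
        by (auto simp: zero_coverings_def coverings_def intro: reachable.step)
    qed
  qed simp
  then show "reachable L V w b x"
    if "\<exists>p. covering_path L b p x \<and> set (zip p (tl p)) \<inter> zero_coverings L V w = {}"
    using that unfolding zip_tl_disjoint_iff covering_path_def successively_conj by blast
qed

section \<open>Coverings in a modular, locally finite lattice\<close>

context fomin_lattice
begin

lemma lless_iff: "x \<sqsubset>\<^bsub>L\<^esub> y \<longleftrightarrow> x \<sqsubseteq>\<^bsub>L\<^esub> y \<and> x \<noteq> y"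
  using eq_is_equal by (simp add: lless_def)

lemma covers_iff:
  "covers L x y \<longleftrightarrow> x \<in> carrier L \<and> y \<in> carrier L \<and> x \<sqsubseteq>\<^bsub>L\<^esub> y \<and> x \<noteq> y \<and>
     (\<forall>z\<in>carrier L. x \<sqsubseteq>\<^bsub>L\<^esub> z \<longrightarrow> z \<sqsubseteq>\<^bsub>L\<^esub> y \<longrightarrow> z = x \<or> z = y)"
  unfolding covers_def lless_iff by blast

lemma join_absorb: "\<lbrakk>x \<in> carrier L; y \<in> carrier L; x \<sqsubseteq>\<^bsub>L\<^esub> y\<rbrakk> \<Longrightarrow> x \<squnion>\<^bsub>L\<^esub> y = y"
  by (intro le_antisym join_le join_right) auto

lemma meet_absorb: "\<lbrakk>x \<in> carrier L; y \<in> carrier L; x \<sqsubseteq>\<^bsub>L\<^esub> y\<rbrakk> \<Longrightarrow> x \<sqinter>\<^bsub>L\<^esub> y = x"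
  by (intro le_antisym meet_le meet_left) auto

text \<open>The map \<open>z \<mapsto> y \<sqinter> z\<close> sends the interval from
  \<open>x\<close> to \<open>x \<squnion> y\<close> into the one from \<open>x \<sqinter> y\<close>
  to \<open>y\<close>. By modularity \<open>x \<squnion> (y \<sqinter> z) = z\<close>, so it is
  injective, and the target has only its two endpoints.\<close>

lemma covers_join:
  assumes x: "x \<in> carrier L" and c: "covers L (x \<sqinter>\<^bsub>L\<^esub> y) y"
  shows "covers L x (x \<squnion>\<^bsub>L\<^esub> y)"
proof -
  have y: "y \<in> carrier L" using c by (simp add: covers_iff)
  have "z = x \<or> z = x \<squnion>\<^bsub>L\<^esub> y"
    if z: "z \<in> carrier L" "x \<sqsubseteq>\<^bsub>L\<^esub> z" "z \<sqsubseteq>\<^bsub>L\<^esub> x \<squnion>\<^bsub>L\<^esub> y" for z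
  proof -
    have "x \<sqinter>\<^bsub>L\<^esub> y \<sqsubseteq>\<^bsub>L\<^esub> y \<sqinter>\<^bsub>L\<^esub> z"
      using x y z by (meson le_trans meet_closed meet_le meet_left meet_right)
    moreover have "y \<sqinter>\<^bsub>L\<^esub> z \<sqsubseteq>\<^bsub>L\<^esub> y" using y z meet_left by blast
    ultimately consider "y \<sqinter>\<^bsub>L\<^esub> z = x \<sqinter>\<^bsub>L\<^esub> y" | "y \<sqinter>\<^bsub>L\<^esub> z = y"
      using c y z by (auto simp: covers_iff)
    moreover have "x \<squnion>\<^bsub>L\<^esub> (y \<sqinter>\<^bsub>L\<^esub> z) = z"
      using modular[of x y z] meet_absorb[of z "x \<squnion>\<^bsub>L\<^esub> y"] meet_comm[of L] x y z by simp
    moreover have "x \<squnion>\<^bsub>L\<^esub> (x \<sqinter>\<^bsub>L\<^esub> y) = x"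
      using join_absorb[of "x \<sqinter>\<^bsub>L\<^esub> y" x] meet_left[of x y] join_comm[of L] x y by simp
    ultimately show ?thesis by cases auto
  qed
  moreover have "x \<noteq> x \<squnion>\<^bsub>L\<^esub> y"
  proof
    assume "x = x \<squnion>\<^bsub>L\<^esub> y"
    then have "y \<sqsubseteq>\<^bsub>L\<^esub> x" using join_right[of x y] x y by simp
    then have "x \<sqinter>\<^bsub>L\<^esub> y = y" using meet_absorb[of y x] meet_comm[of L] x y by simp
    with c show False by (simp add: covers_iff)
  qed
  ultimately show ?thesis using x y join_left[of x y] by (auto simp: covers_iff)
qed

text \<open>Dual argument: \<open>z\<close> is sent to \<open>z \<squnion> y\<close>, and modularity
  recovers it by meeting with \<open>x\<close>.\<close>

lemma covers_meet:
  assumes x: "x \<in> carrier L" and c: "covers L y (x \<squnion>\<^bsub>L\<^esub> y)"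
  shows "covers L (x \<sqinter>\<^bsub>L\<^esub> y) x"
proof -
  have y: "y \<in> carrier L" using c by (simp add: covers_iff)
  have "z = x \<sqinter>\<^bsub>L\<^esub> y \<or> z = x"
    if z: "z \<in> carrier L" "x \<sqinter>\<^bsub>L\<^esub> y \<sqsubseteq>\<^bsub>L\<^esub> z" "z \<sqsubseteq>\<^bsub>L\<^esub> x" for z
  proof -
    have "z \<squnion>\<^bsub>L\<^esub> y \<sqsubseteq>\<^bsub>L\<^esub> x \<squnion>\<^bsub>L\<^esub> y"
      using x y z by (meson le_trans join_closed join_le join_left join_right)
    moreover have "y \<sqsubseteq>\<^bsub>L\<^esub> z \<squnion>\<^bsub>L\<^esub> y" using y z join_right by blast
    ultimately consider "z \<squnion>\<^bsub>L\<^esub> y = x \<squnion>\<^bsub>L\<^esub> y" | "z \<squnion>\<^bsub>L\<^esub> y = y"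
      using c y z by (auto simp: covers_iff)
    moreover have "(z \<squnion>\<^bsub>L\<^esub> y) \<sqinter>\<^bsub>L\<^esub> x = z"
      using modular[of z y x] join_absorb[of "x \<sqinter>\<^bsub>L\<^esub> y" z] meet_comm[of L] join_comm[of L] x y z
      by simp
    moreover have "(x \<squnion>\<^bsub>L\<^esub> y) \<sqinter>\<^bsub>L\<^esub> x = x"
      using meet_absorb[of x "x \<squnion>\<^bsub>L\<^esub> y"] join_left[of x y] meet_comm[of L] x y by simp
    ultimately show ?thesis using meet_comm[of L x y] by metis
  qed
  moreover have "x \<sqinter>\<^bsub>L\<^esub> y \<noteq> x"
  proof
    assume "x \<sqinter>\<^bsub>L\<^esub> y = x"
    then have "x \<sqsubseteq>\<^bsub>L\<^esub> y" using meet_right[of x y] x y by simp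
    then have "x \<squnion>\<^bsub>L\<^esub> y = y" using join_absorb[of x y] x y by simp
    with c show False by (simp add: covers_iff)
  qed
  ultimately show ?thesis using x y meet_left[of x y] by (auto simp: covers_iff)
qed

text \<open>If \<open>y\<close> does not cover \<open>x\<close>, an element strictly between them
  spans a smaller finite interval with \<open>x\<close>, so the descent ends at a covering.\<close>

lemma ex_cover_below:
  assumes "x \<in> carrier L" "y \<in> carrier L" "x \<sqsubseteq>\<^bsub>L\<^esub> y" "x \<noteq> y"
  shows "\<exists>z. covers L x z \<and> z \<sqsubseteq>\<^bsub>L\<^esub> y"
  using assms
proof (induction "card \<lbrace>x..y\<rbrace>\<^bsub>L\<^esub>" arbitrary: y rule: less_induct)
  case less
  show ?case
  proof (cases "covers L x y")
    case True
    with less.prems show ?thesis by auto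
  next
    case False
    then obtain z where z: "z \<in> carrier L" "x \<sqsubseteq>\<^bsub>L\<^esub> z" "z \<sqsubseteq>\<^bsub>L\<^esub> y" "z \<noteq> x" "z \<noteq> y"
      using less.prems by (auto simp: covers_iff)
    have "\<lbrace>x..z\<rbrace>\<^bsub>L\<^esub> \<subseteq> \<lbrace>x..y\<rbrace>\<^bsub>L\<^esub>"
      using z less.prems by (auto simp: at_least_at_most_def intro: le_trans)
    moreover have "y \<in> \<lbrace>x..y\<rbrace>\<^bsub>L\<^esub> - \<lbrace>x..z\<rbrace>\<^bsub>L\<^esub>"
      using z less.prems le_antisym by (auto simp: at_least_at_most_def)
    ultimately have "card \<lbrace>x..z\<rbrace>\<^bsub>L\<^esub> < card \<lbrace>x..y\<rbrace>\<^bsub>L\<^esub>"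
      using less.prems by (intro psubset_card_mono locally_finite) auto
    from less.hyps[OF this] obtain u where "covers L x u" "u \<sqsubseteq>\<^bsub>L\<^esub> z"
      using less.prems z by blast
    then show ?thesis
      using z less.prems le_trans by (meson covers_iff)
  qed
qed

section \<open>Weights of perspective coverings\<close>

text \<open>A ladder of squares between the two coverings carries the weight across. The first
  square is spanned by \<open>c\<close> and a cover \<open>e\<close> of
  \<open>d \<sqinter> c\<close> below \<open>d\<close>; the rest of the ladder starts at
  \<open>e\<close> and lies over a smaller interval.\<close>

lemma weight_perspective:
  assumes "d \<in> carrier L" "covers L (d \<sqinter>\<^bsub>L\<^esub> c) c"
  shows "w (d, d \<squnion>\<^bsub>L\<^esub> c) = w (d \<sqinter>\<^bsub>L\<^esub> c, c)"
  using assms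
proof (induction "card \<lbrace>d \<sqinter>\<^bsub>L\<^esub> c..d\<rbrace>\<^bsub>L\<^esub>" arbitrary: c rule: less_induct)
  case less
  note d = \<open>d \<in> carrier L\<close>
  have c: "c \<in> carrier L" using less.prems by (simp add: covers_iff)
  let ?a = "d \<sqinter>\<^bsub>L\<^esub> c"
  have a: "?a \<in> carrier L" "?a \<sqsubseteq>\<^bsub>L\<^esub> d" "?a \<sqsubseteq>\<^bsub>L\<^esub> c"
    using c d meet_left meet_right by auto
  show ?case
  proof (cases "?a = d")
    \<comment> \<open>Here \<open>d\<close> lies below \<open>c\<close>, and both coverings are the
      same pair.\<close>
    case True
    then have "d \<squnion>\<^bsub>L\<^esub> c = c" using a c d join_absorb by simp
    with True show ?thesis by simp
  next
    case False
    then obtain e where e: "covers L ?a e" "e \<sqsubseteq>\<^bsub>L\<^esub> d"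
      using ex_cover_below a d by blast
    then have eL: "e \<in> carrier L" "?a \<sqsubseteq>\<^bsub>L\<^esub> e" "?a \<noteq> e" by (auto simp: covers_iff)
    have ec: "e \<sqinter>\<^bsub>L\<^esub> c = ?a"
    proof (rule le_antisym)
      show "e \<sqinter>\<^bsub>L\<^esub> c \<sqsubseteq>\<^bsub>L\<^esub> ?a"
        using e eL c d by (meson le_trans meet_closed meet_le meet_left meet_right)
      show "?a \<sqsubseteq>\<^bsub>L\<^esub> e \<sqinter>\<^bsub>L\<^esub> c" using a eL c by (intro meet_le)
    qed (use c d eL in auto)
    \<comment> \<open>Both \<open>e\<close> and \<open>c\<close> cover their common meet, so both
      are covered by their join: this is a square to which \<open>projective_constant\<close>
      applies.\<close>
    have cov: "covers L e (e \<squnion>\<^bsub>L\<^esub> c)" "covers L c (e \<squnion>\<^bsub>L\<^esub> c)"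
      using covers_join[of e c] covers_join[of c e] ec e eL c less.prems
        meet_comm[of L c e] join_comm[of L c e] by auto
    have *: "w (e, e \<squnion>\<^bsub>L\<^esub> c) = w (?a, c)"
      using projective_constant[of e c] cov ec e less.prems by simp
    \<comment> \<open>With \<open>dj\<close>, this shows that \<open>e \<squnion> c\<close> in place
      of \<open>c\<close> yields the same upper covering above \<open>d\<close>, now with lower
      covering from \<open>e\<close> to \<open>e \<squnion> c\<close>.\<close>
    have de: "d \<sqinter>\<^bsub>L\<^esub> (e \<squnion>\<^bsub>L\<^esub> c) = e"
    proof -
      have "e \<squnion>\<^bsub>L\<^esub> (c \<sqinter>\<^bsub>L\<^esub> d) = (e \<squnion>\<^bsub>L\<^esub> c) \<sqinter>\<^bsub>L\<^esub> d" by (rule modular) (use e eL c d in auto)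
      moreover have "e \<squnion>\<^bsub>L\<^esub> ?a = e" using join_absorb[of ?a e] a eL join_comm[of L] by simp
      ultimately show ?thesis using meet_comm[of L] by metis
    qed
    have dj: "d \<squnion>\<^bsub>L\<^esub> (e \<squnion>\<^bsub>L\<^esub> c) = d \<squnion>\<^bsub>L\<^esub> c"
    proof -
      have "d \<squnion>\<^bsub>L\<^esub> (e \<squnion>\<^bsub>L\<^esub> c) = (d \<squnion>\<^bsub>L\<^esub> e) \<squnion>\<^bsub>L\<^esub> c"
        using weak_join_assoc[of d e c] c d eL eq_is_equal by simp
      also have "d \<squnion>\<^bsub>L\<^esub> e = d" using join_absorb[of e d] e eL d join_comm[of L] by simp
      finally show ?thesis .
    qed
    have "\<lbrace>e..d\<rbrace>\<^bsub>L\<^esub> \<subseteq> \<lbrace>?a..d\<rbrace>\<^bsub>L\<^esub>"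
      using a eL d le_trans[of ?a e] by (auto simp: at_least_at_most_def)
    moreover have "?a \<in> \<lbrace>?a..d\<rbrace>\<^bsub>L\<^esub> - \<lbrace>e..d\<rbrace>\<^bsub>L\<^esub>"
      using a eL le_antisym by (auto simp: at_least_at_most_def)
    ultimately have "card \<lbrace>e..d\<rbrace>\<^bsub>L\<^esub> < card \<lbrace>?a..d\<rbrace>\<^bsub>L\<^esub>"
      using a d by (intro psubset_card_mono locally_finite) auto
    then show ?thesis
      using less.hyps[of "e \<squnion>\<^bsub>L\<^esub> c"] de dj cov d * by simp
  qed
qed

section \<open>Closure properties of reachable elements\<close>

lemma reachable_closed: "\<lbrakk>reachable L V w b x; b \<in> carrier L\<rbrakk> \<Longrightarrow> x \<in> carrier L"
  by (induction rule: reachable.induct) (auto simp: covers_iff)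

text \<open>Joining \<open>x\<close> with every element of the path to \<open>y\<close> gives a path
  from \<open>x\<close>: each covering either collapses or becomes a perspective covering of the
  same nonzero weight. The induction follows the path to \<open>y\<close> while \<open>x\<close>
  stays fixed.\<close>

lemma reachable_join:
  assumes "reachable L V w b y" "reachable L V w b x" "least L b (carrier L)"
  shows "reachable L V w b (x \<squnion>\<^bsub>L\<^esub> y)"
  using assms
proof induction
  case base
  then have "b \<in> carrier L" "x \<in> carrier L" "b \<sqsubseteq>\<^bsub>L\<^esub> x"
    by (auto simp: least_def dest: reachable_closed)
  then show ?case using join_absorb[of b x] join_comm[of L] base by simp
next
  case (step y y')
  let ?d = "x \<squnion>\<^bsub>L\<^esub> y"
  have b: "b \<in> carrier L" using step.prems by (simp add: least_def)
  have x: "x \<in> carrier L" using step.prems b reachable_closed by blast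
  have y: "y \<in> carrier L" "y' \<in> carrier L" "y \<sqsubseteq>\<^bsub>L\<^esub> y'" using step.hyps by (auto simp: covers_iff)
  have d: "?d \<in> carrier L" using x y by simp
  have rd: "reachable L V w b ?d" using step by blast
  have dy: "?d \<squnion>\<^bsub>L\<^esub> y' = x \<squnion>\<^bsub>L\<^esub> y'"
    using weak_join_assoc[of x y y'] join_absorb[of y y'] x y eq_is_equal by simp
  have "y \<sqsubseteq>\<^bsub>L\<^esub> ?d \<sqinter>\<^bsub>L\<^esub> y'" using x y d join_right by (intro meet_le) auto
  moreover have "?d \<sqinter>\<^bsub>L\<^esub> y' \<sqsubseteq>\<^bsub>L\<^esub> y'" using d y meet_right by blast
  \<comment> \<open>The meet lies between \<open>y\<close> and its cover \<open>y'\<close>. In the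
    first case the covering moves up to \<open>?d\<close>; in the second it collapses.\<close>
  ultimately consider "?d \<sqinter>\<^bsub>L\<^esub> y' = y" | "?d \<sqinter>\<^bsub>L\<^esub> y' = y'"
    using step.hyps d y by (auto simp: covers_iff)
  then show ?case
  proof cases
    case 1
    then have "covers L ?d (?d \<squnion>\<^bsub>L\<^esub> y')" "w (?d, ?d \<squnion>\<^bsub>L\<^esub> y') = w (y, y')"
      using covers_join[of ?d y'] weight_perspective[of ?d y'] d step.hyps by auto
    then show ?thesis using rd step.hyps dy by (metis reachable.step)
  next
    case 2
    then have "y' \<sqsubseteq>\<^bsub>L\<^esub> ?d" using meet_left[of ?d y'] d y by simp
    then have "?d \<squnion>\<^bsub>L\<^esub> y' = ?d" using join_absorb[of y' ?d] join_comm[of L] d y by simp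
    with dy rd show ?thesis by simp
  qed
qed

text \<open>If \<open>y\<close> is not already below the next to last element \<open>x\<close> of
  the path, then \<open>y \<squnion> x = x'\<close>. The last covering is then perspective to the
  one from \<open>x \<sqinter> y\<close> to \<open>y\<close>, and \<open>x \<sqinter> y\<close> is
  reachable by induction.\<close>

lemma reachable_downward:
  assumes "reachable L V w b x" "least L b (carrier L)" "y \<in> carrier L" "y \<sqsubseteq>\<^bsub>L\<^esub> x"
  shows "reachable L V w b y"
  using assms
proof (induction arbitrary: y)
  case base
  then have "y = b" by (intro le_antisym) (auto simp: least_def)
  then show ?case by (simp add: reachable.base)
next
  case (step x x')
  have x: "x \<in> carrier L" "x' \<in> carrier L" "x \<sqsubseteq>\<^bsub>L\<^esub> x'" using step.hyps by (auto simp: covers_iff)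
  note y = \<open>y \<in> carrier L\<close> \<open>y \<sqsubseteq>\<^bsub>L\<^esub> x'\<close>
  show ?case
  proof (cases "y \<sqsubseteq>\<^bsub>L\<^esub> x")
    case True
    with step show ?thesis by blast
  next
    case False
    have "x \<sqsubseteq>\<^bsub>L\<^esub> y \<squnion>\<^bsub>L\<^esub> x" "y \<sqsubseteq>\<^bsub>L\<^esub> y \<squnion>\<^bsub>L\<^esub> x" "y \<squnion>\<^bsub>L\<^esub> x \<sqsubseteq>\<^bsub>L\<^esub> x'"
      using x y join_left join_right join_le by auto
    with False have eq: "y \<squnion>\<^bsub>L\<^esub> x = x'"
      using step.hyps x y join_closed[of y x] by (metis covers_iff)
    then have c: "covers L (x \<sqinter>\<^bsub>L\<^esub> y) y"
      using covers_meet[of y x] step.hyps y meet_comm[of L] by metis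
    then have "w (x \<sqinter>\<^bsub>L\<^esub> y, y) = w (x, x')"
      using weight_perspective[of x y] eq x join_comm[of L] by metis
    moreover have "reachable L V w b (x \<sqinter>\<^bsub>L\<^esub> y)"
      using step x y meet_left by simp
    ultimately show ?thesis using step.hyps c by (metis reachable.step)
  qed
qed

text \<open>The given path controls only its own last covering, from \<open>x\<close> to
  \<open>x'\<close>. For another lower cover \<open>y\<close> of \<open>x'\<close>, perspectivity
  moves the covering down to one ending in \<open>x\<close>, where induction applies. Thus the
  choice of path does not matter.\<close>

lemma reachable_weight_nonzero:
  assumes "reachable L V w b x" "least L b (carrier L)" "covers L y x"
  shows "w (y, x) \<noteq> \<zero>\<^bsub>V\<^esub>"
  using assms
proof (induction arbitrary: y)
  case base
  then have "y = b" by (intro le_antisym) (auto simp: least_def covers_iff)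
  then show ?case using base by (simp add: covers_iff)
next
  case (step x x')
  have x: "x \<in> carrier L" "x' \<in> carrier L" "x \<sqsubseteq>\<^bsub>L\<^esub> x'" "x \<noteq> x'"
    using step.hyps by (auto simp: covers_iff)
  have y: "y \<in> carrier L" "y \<sqsubseteq>\<^bsub>L\<^esub> x'" "y \<noteq> x'"
    using step.prems by (auto simp: covers_iff)
  show ?case
  proof (cases "y = x")
    case True
    with step show ?thesis by simp
  next
    case False
    have le: "x \<sqsubseteq>\<^bsub>L\<^esub> y \<squnion>\<^bsub>L\<^esub> x" "y \<sqsubseteq>\<^bsub>L\<^esub> y \<squnion>\<^bsub>L\<^esub> x" "y \<squnion>\<^bsub>L\<^esub> x \<sqsubseteq>\<^bsub>L\<^esub> x'"
      using x y join_left join_right join_le by auto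
    \<comment> \<open>A join different from \<open>x'\<close> would have to equal both
      \<open>x\<close> and \<open>y\<close>, as \<open>x'\<close> covers each of them.\<close>
    have eq: "y \<squnion>\<^bsub>L\<^esub> x = x'"
    proof (rule ccontr)
      assume "y \<squnion>\<^bsub>L\<^esub> x \<noteq> x'"
      then have "y \<squnion>\<^bsub>L\<^esub> x = x" "y \<squnion>\<^bsub>L\<^esub> x = y"
        using step.hyps step.prems x y le join_closed[of y x] by (metis covers_iff)+
      with False show False by simp
    qed
    then have c: "covers L (y \<sqinter>\<^bsub>L\<^esub> x) x"
      using covers_meet[of x y] step.prems x meet_comm[of L] join_comm[of L] by metis
    then have "w (y, x') = w (y \<sqinter>\<^bsub>L\<^esub> x, x)"
      using weight_perspective[of y x] eq y by simp
    then show ?thesis using step.IH step.prems c by simp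
  qed
qed

section \<open>The truncation as the set of reachable elements\<close>

text \<open>As \<open>b\<close> is the minimum, \<open>x \<sqinter> b = b\<close> and
  \<open>x \<squnion> b = x\<close>, so the path in \<open>trunc_equiv\<close> runs from
  \<open>b\<close> to \<open>x\<close>.\<close>

lemma carrier_truncation:
  assumes "least L b (carrier L)"
  shows "carrier (truncation L V w b) = {x. reachable L V w b x}"
proof -
  have b: "b \<in> carrier L" using assms by (simp add: least_def)
  have "trunc_equiv L V w x b \<longleftrightarrow> reachable L V w b x" if x: "x \<in> carrier L" for x
  proof -
    have "b \<sqsubseteq>\<^bsub>L\<^esub> x" using assms x by (simp add: least_def)
    then have "x \<sqinter>\<^bsub>L\<^esub> b = b" "x \<squnion>\<^bsub>L\<^esub> b = x"
      using meet_absorb[of b x] join_absorb[of b x] meet_comm[of L] join_comm[of L] b x by auto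
    then show ?thesis by (simp add: trunc_equiv_def reachable_iff_path[OF b])
  qed
  then show ?thesis using reachable_closed b by (auto simp: truncation_def)
qed

lemma sublattice_truncation:
  assumes "least L b (carrier L)"
  shows "sublattice_carrier (carrier (truncation L V w b)) L"
proof -
  have b: "b \<in> carrier L" using assms by (simp add: least_def)
  have "reachable L V w b (x \<sqinter>\<^bsub>L\<^esub> y)" if "reachable L V w b x" "reachable L V w b y" for x y
    using that reachable_downward[of b x "x \<sqinter>\<^bsub>L\<^esub> y"] assms meet_left[of x y] b reachable_closed
    by simp
  then show ?thesis
    using reachable_closed b reachable_join assms
    by (auto simp: sublattice_carrier_def carrier_truncation)
qed

text \<open>Restricting an order can create new coverings; here it does not, since an element of
  \<open>L\<close> between \<open>x\<close> and a reachable \<open>y\<close> is itself reachable by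
  downward closure.\<close>

lemma covers_truncation_iff:
  assumes "least L b (carrier L)"
  shows "covers (truncation L V w b) x y \<longleftrightarrow>
    covers L x y \<and> reachable L V w b x \<and> reachable L V w b y"
proof -
  have b: "b \<in> carrier L" using assms by (simp add: least_def)
  have "(x \<sqsubset>\<^bsub>truncation L V w b\<^esub> y) = (x \<sqsubset>\<^bsub>L\<^esub> y)" for x y
    by (simp add: truncation_def lless_def)
  then show ?thesis
    using reachable_downward[OF _ assms] reachable_closed[OF _ b]
    unfolding covers_def carrier_truncation[OF assms] mem_Collect_eq
    by (metis lless_iff)
qed

end

section \<open>Sublattices as lattices in their own right\<close>

lemma (in lattice) join_sublattice:
  assumes "sublattice_carrier A L" "x \<in> A" "y \<in> A"
  shows "least (L\<lparr>carrier := A\<rparr>) (x \<squnion>\<^bsub>L\<^esub> y) (Upper (L\<lparr>carrier := A\<rparr>) {x, y})"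
  using assms join_left[of x y] join_right[of x y]
  by (auto simp: least_def Upper_def sublattice_carrier_def subset_iff intro!: join_le)

lemma (in lattice) meet_sublattice:
  assumes "sublattice_carrier A L" "x \<in> A" "y \<in> A"
  shows "greatest (L\<lparr>carrier := A\<rparr>) (x \<sqinter>\<^bsub>L\<^esub> y) (Lower (L\<lparr>carrier := A\<rparr>) {x, y})"
  using assms meet_left[of x y] meet_right[of x y]
  by (auto simp: greatest_def Lower_def sublattice_carrier_def subset_iff intro!: meet_le)

lemma (in lattice) lattice_sublattice:
  assumes "sublattice_carrier A L"
  shows "lattice (L\<lparr>carrier := A\<rparr>)"
proof -
  have A: "x \<in> carrier L" if "x \<in> A" for x using assms that by (auto simp: sublattice_carrier_def)
  show ?thesis
  proof unfold_locales
    fix x y assume "x \<in> carrier (L\<lparr>carrier := A\<rparr>)" "y \<in> carrier (L\<lparr>carrier := A\<rparr>)"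
    then have "x \<in> A" "y \<in> A" by auto
    then show "\<exists>s. least (L\<lparr>carrier := A\<rparr>) s (Upper (L\<lparr>carrier := A\<rparr>) {x, y})"
      "\<exists>s. greatest (L\<lparr>carrier := A\<rparr>) s (Lower (L\<lparr>carrier := A\<rparr>) {x, y})"
      by (blast intro: join_sublattice[OF assms] meet_sublattice[OF assms])+
  qed (use A eq_is_equal in \<open>auto intro: le_trans\<close>)
qed

text \<open>The operations of the restricted structure refer to bounds within \<open>A\<close> only,
  so their agreement with those of \<open>L\<close> is derived from both universal properties by
  antisymmetry.\<close>

lemma (in lattice) join_meet_sublattice_eq:
  assumes "sublattice_carrier A L" "x \<in> A" "y \<in> A"
  shows "x \<squnion>\<^bsub>L\<lparr>carrier := A\<rparr>\<^esub> y = x \<squnion>\<^bsub>L\<^esub> y" "x \<sqinter>\<^bsub>L\<lparr>carrier := A\<rparr>\<^esub> y = x \<sqinter>\<^bsub>L\<^esub> y"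
proof -
  interpret S: lattice "L\<lparr>carrier := A\<rparr>" by (rule lattice_sublattice) fact
  have A: "A \<subseteq> carrier L" "x \<squnion>\<^bsub>L\<^esub> y \<in> A" "x \<sqinter>\<^bsub>L\<^esub> y \<in> A"
    using assms by (auto simp: sublattice_carrier_def)
  have J: "x \<squnion>\<^bsub>L\<lparr>carrier := A\<rparr>\<^esub> y \<in> A" "x \<sqinter>\<^bsub>L\<lparr>carrier := A\<rparr>\<^esub> y \<in> A"
    using S.join_closed[of x y] S.meet_closed[of x y] assms by auto
  have xy: "x \<in> carrier L" "y \<in> carrier L" "x \<squnion>\<^bsub>L\<lparr>carrier := A\<rparr>\<^esub> y \<in> carrier L"
    "x \<sqinter>\<^bsub>L\<lparr>carrier := A\<rparr>\<^esub> y \<in> carrier L"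
    using assms A J by auto
  show "x \<squnion>\<^bsub>L\<lparr>carrier := A\<rparr>\<^esub> y = x \<squnion>\<^bsub>L\<^esub> y"
  proof (rule le_antisym)
    show "x \<squnion>\<^bsub>L\<lparr>carrier := A\<rparr>\<^esub> y \<sqsubseteq>\<^bsub>L\<^esub> x \<squnion>\<^bsub>L\<^esub> y"
      using S.join_le[of x "x \<squnion>\<^bsub>L\<^esub> y" y] join_left[of x y] join_right[of x y] assms A xy by simp
    show "x \<squnion>\<^bsub>L\<^esub> y \<sqsubseteq>\<^bsub>L\<^esub> x \<squnion>\<^bsub>L\<lparr>carrier := A\<rparr>\<^esub> y"
      using S.join_left[of x y] S.join_right[of x y] assms xy by (intro join_le) auto
  qed (use xy in auto)
  show "x \<sqinter>\<^bsub>L\<lparr>carrier := A\<rparr>\<^esub> y = x \<sqinter>\<^bsub>L\<^esub> y"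
  proof (rule le_antisym)
    show "x \<sqinter>\<^bsub>L\<^esub> y \<sqsubseteq>\<^bsub>L\<^esub> x \<sqinter>\<^bsub>L\<lparr>carrier := A\<rparr>\<^esub> y"
      using S.meet_le[of "x \<sqinter>\<^bsub>L\<^esub> y" x y] meet_left[of x y] meet_right[of x y] assms A xy by simp
    show "x \<sqinter>\<^bsub>L\<lparr>carrier := A\<rparr>\<^esub> y \<sqsubseteq>\<^bsub>L\<^esub> x \<sqinter>\<^bsub>L\<^esub> y"
      using S.meet_left[of x y] S.meet_right[of x y] assms xy by (intro meet_le) auto
  qed (use xy in auto)
qed

section \<open>The Fomin conditions for the truncation\<close>

lemma (in fomin_lattice) fomin_lattice_truncation:
  assumes least: "least L b (carrier L)"
  defines "T \<equiv> truncation L V w b"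
  shows "fomin_lattice T R V r (restrict w (coverings T))"
proof -
  define A where "A = {x. reachable L V w b x}"
  have b: "b \<in> carrier L" using least by (simp add: least_def)
  have carT: "carrier T = A" using least by (simp add: T_def A_def carrier_truncation)
  have T: "T = L\<lparr>carrier := A\<rparr>" using carT by (simp add: T_def truncation_def)
  have sub: "sublattice_carrier A L" using sublattice_truncation[OF least] carT T_def by simp
  then have AL: "A \<subseteq> carrier L" and
    Acl: "\<And>x y. \<lbrakk>x \<in> A; y \<in> A\<rbrakk> \<Longrightarrow> x \<squnion>\<^bsub>L\<^esub> y \<in> A \<and> x \<sqinter>\<^bsub>L\<^esub> y \<in> A"
    by (auto simp: sublattice_carrier_def)
  have leT: "x \<sqsubseteq>\<^bsub>T\<^esub> y \<longleftrightarrow> x \<sqsubseteq>\<^bsub>L\<^esub> y" for x y by (simp add: T)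
  note ops = join_meet_sublattice_eq[OF sub, folded T]
  have covT: "covers T x y \<longleftrightarrow> covers L x y \<and> x \<in> A \<and> y \<in> A" for x y
    using covers_truncation_iff[OF least] by (simp add: T_def A_def)
  \<comment> \<open>The default \<open>undefined\<close> never enters the conditions to be shown:
    they evaluate the weighting only at coverings of \<open>T\<close>.\<close>
  have res: "restrict w (coverings T) (x, y) = (if covers T x y then w (x, y) else undefined)" for x y
    by (simp add: coverings_def)
  have wcl: "w (x, y) \<in> carrier V" if "covers L x y" for x y
    using that weight_closed by (auto simp: coverings_def)
  have lower: "{y. covers T y x} = {y. covers L y x}" if "x \<in> A" for x
    using that reachable_downward[OF _ least] by (auto simp: covT A_def covers_iff)
  interpret S: lattice T unfolding T by (rule lattice_sublattice) fact
  show ?thesis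
  proof (intro fomin_lattice.intro fomin_lattice_axioms.intro)
    show "lattice T" by (rule S.lattice_axioms)
    show "left_module R V" by (rule left_module_axioms)
    show "r \<in> carrier V" by (rule degree_closed)
    show "restrict w (coverings T) \<in> coverings T \<rightarrow> carrier V"
      using wcl by (auto simp: coverings_def covT)
    show "x \<squnion>\<^bsub>T\<^esub> (y \<sqinter>\<^bsub>T\<^esub> z) = (x \<squnion>\<^bsub>T\<^esub> y) \<sqinter>\<^bsub>T\<^esub> z"
      if "x \<in> carrier T" "y \<in> carrier T" "z \<in> carrier T" "x \<sqsubseteq>\<^bsub>T\<^esub> z" for x y z
      using that AL Acl modular[of x y z] by (auto simp: carT leT ops)
    show "finite \<lbrace>x..y\<rbrace>\<^bsub>T\<^esub>" if "x \<in> carrier T" "y \<in> carrier T" for x y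
      using that AL by (intro finite_subset[OF _ locally_finite[of x y]])
        (auto simp: at_least_at_most_def carT leT)
    show "finite {z. covers T x z}" if "x \<in> carrier T" for x
      using that AL by (intro finite_subset[OF _ finite_upper_covers[of x]]) (auto simp: carT covT)
    show "finite {y. covers T y x}" if "x \<in> carrier T" for x
      using that AL by (intro finite_subset[OF _ finite_lower_covers[of x]]) (auto simp: carT covT)
    show "(\<Oplus>\<^bsub>V\<^esub>y\<in>{y. covers T y x}. restrict w (coverings T) (y, x)) \<oplus>\<^bsub>V\<^esub> r =
        (\<Oplus>\<^bsub>V\<^esub>z\<in>{z. covers T x z}. restrict w (coverings T) (x, z))" if "x \<in> carrier T" for x
    proof -
      have x: "x \<in> A" "x \<in> carrier L" using that AL by (auto simp: carT)
      have "(\<Oplus>\<^bsub>V\<^esub>y\<in>{y. covers T y x}. restrict w (coverings T) (y, x)) =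
          (\<Oplus>\<^bsub>V\<^esub>y\<in>{y. covers L y x}. w (y, x))"
        unfolding lower[OF x(1)]
        by (rule V.add.finprod_cong') (use lower[OF x(1)] wcl in \<open>auto simp: res simp del: restrict_apply\<close>)
      \<comment> \<open>An upper cover of \<open>x\<close> outside \<open>A\<close> has weight zero,
        for otherwise \<open>reachable.step\<close> would put it into \<open>A\<close>; the finite
        sum is unchanged by such terms.\<close>
      moreover have "(\<Oplus>\<^bsub>V\<^esub>z\<in>{z. covers T x z}. restrict w (coverings T) (x, z)) =
          (\<Oplus>\<^bsub>V\<^esub>z\<in>{z. covers L x z}. w (x, z))"
        by (rule V.add.finprod_mono_neutral_cong_left)
          (use finite_upper_covers x wcl reachable.step[of L V w b x] in
            \<open>auto simp: res covT A_def simp del: restrict_apply\<close>)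
      ultimately show ?thesis using differential[OF x(2)] by simp
    qed
    show "restrict w (coverings T) (x \<sqinter>\<^bsub>T\<^esub> y, x) = restrict w (coverings T) (y, x \<squnion>\<^bsub>T\<^esub> y) \<and>
        restrict w (coverings T) (x \<sqinter>\<^bsub>T\<^esub> y, y) = restrict w (coverings T) (x, x \<squnion>\<^bsub>T\<^esub> y)"
      if c: "covers T x (x \<squnion>\<^bsub>T\<^esub> y)" "covers T y (x \<squnion>\<^bsub>T\<^esub> y)"
        "covers T (x \<sqinter>\<^bsub>T\<^esub> y) x" "covers T (x \<sqinter>\<^bsub>T\<^esub> y) y" for x y
    proof -
      have "x \<in> A" "y \<in> A" using c by (auto simp: covT)
      \<comment> \<open>The restriction is evaluated while the premises still speak of coverings of
        \<open>T\<close>; these are then turned into coverings of \<open>L\<close> to use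
        \<open>projective_constant\<close>.\<close>
      then show ?thesis
        using c projective_constant[of x y] by (simp add: res ops del: restrict_apply) (simp add: covT)
    qed
  qed
qed

theorem theorem4p16:
  fixes L :: "('a, 'm) gorder_scheme" and R :: "('k, 'l) ring_scheme"
    and V :: "('k, 'v, 'n) module_scheme" and r :: 'v and w :: "'a \<times> 'a \<Rightarrow> 'v" and b :: 'a
  assumes "fomin_lattice L R V r w"
    and "least L b (carrier L)"
  defines "T \<equiv> truncation L V w b"
  shows "sublattice_carrier (carrier T) L \<and>
         coverings T \<subseteq> coverings L \<and>
         fomin_lattice T R V r (restrict w (coverings T)) \<and>
         least T b (carrier T)"
proof -
  interpret fomin_lattice L R V r w by fact
  note least = \<open>least L b (carrier L)\<close>
  have sub: "sublattice_carrier (carrier T) L"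
    unfolding T_def by (rule sublattice_truncation) fact
  have "coverings T \<subseteq> coverings L"
    using covers_truncation_iff[OF least] by (auto simp: T_def coverings_def)
  moreover have "b \<in> carrier T"
    using least by (simp add: T_def carrier_truncation reachable.base)
  then have "least T b (carrier T)"
    using least by (auto simp: least_def T_def truncation_def)
  ultimately show ?thesis
    using sub fomin_lattice_truncation[OF least] by (simp add: T_def)
qed

end
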